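(* For every $\gamma \in [0,1]$, the ideal $M^{\omega}_{\gamma} = \{ f \in C^{\omega}[0,1] \mid f(\gamma) = 0 \}$ of the ring $C^{\omega}[0,1]$ is a principal ideal generated by the function $x - \gamma$.
   Context: $C^{\omega}[0,1]$ is the ring (pointwise operations) of real analytic functions $f:[0,1]\to\mathbb{R}$, i.e. functions such that for each $a \in [0,1]$ there is a real power series centered at $a$ that converges to $f(x)$ for all $x$ in some relatively open neighborhood of $a$ in $[0,1]$ (one-sided at the endpoints). *)

theory Defs
  imports "HOL-Analysis.Analysis" "HOL-Algebra.Ideal"
begin

definition real_analytic_on :: "(real \<Rightarrow> real) \<Rightarrow> real set \<Rightarrow> bool" where
  "real_analytic_on f S \<longleftrightarrow>
     (\<forall>a\<in>S. \<exists>c U. openin (top_of_set S) U \<and> a \<in> U \<and>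
       (\<forall>x\<in>U. (\<lambda>n. c n * (x - a) ^ n) sums f x))"

(* Functions [0,1] -> R are encoded as functions on the reals that are
   extensional on {0..1}, so that equality of ring elements is equality on [0,1]. *)
definition analytic_ring :: "(real \<Rightarrow> real) ring" where
  "analytic_ring =
     \<lparr>carrier = {f \<in> extensional {0..1}. real_analytic_on f {0..1}},
      monoid.mult = (\<lambda>f g. \<lambda>x\<in>{0..1}. f x * g x),
      one = (\<lambda>x\<in>{0..1}. 1),
      zero = (\<lambda>x\<in>{0..1}. 0),
      add = (\<lambda>f g. \<lambda>x\<in>{0..1}. f x + g x)\<rparr>"

definition vanishing_ideal :: "real \<Rightarrow> (real \<Rightarrow> real) set" where
  "vanishing_ideal \<gamma> = {f \<in> carrier analytic_ring. f \<gamma> = 0}"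

end

theory Submission
  imports Defs
begin

text \<open>
  Near \<open>\<gamma>\<close> a function \<open>f\<close> vanishing at \<open>\<gamma>\<close> has a power series with zero constant term, and shifting
  the coefficients divides it by \<open>x - \<gamma>\<close>. Near any other point \<open>1 / (x - \<gamma>)\<close> is a geometric
  series, so the quotient is analytic there as a (Cauchy) product.
\<close>

text \<open>Analyticity is isolated at one point, with a radius in place of a relatively open set:
  two expansions can then be compared on the smaller of their radii.\<close>

definition powser_at :: "(real \<Rightarrow> real) \<Rightarrow> real \<Rightarrow> real set \<Rightarrow> bool" where
  "powser_at f a S \<longleftrightarrow>
     (\<exists>c r. r > 0 \<and> (\<forall>x\<in>S. \<bar>x - a\<bar> < r \<longrightarrow> (\<lambda>n. c n * (x - a) ^ n) sums f x))"

lemma powser_atI: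
  assumes "r > 0" "\<And>x. x \<in> S \<Longrightarrow> \<bar>x - a\<bar> < r \<Longrightarrow> (\<lambda>n. c n * (x - a) ^ n) sums f x"
  shows "powser_at f a S"
  unfolding powser_at_def by (intro exI[of _ c] exI[of _ r]) (simp add: assms)

lemma powser_atE:
  assumes "powser_at f a S"
  obtains c r where "r > 0"
    "\<And>x. x \<in> S \<Longrightarrow> \<bar>x - a\<bar> < r \<Longrightarrow> (\<lambda>n. c n * (x - a) ^ n) sums f x"
proof -
  from assms obtain c where "\<exists>r>0. \<forall>x\<in>S. \<bar>x - a\<bar> < r \<longrightarrow> (\<lambda>n. c n * (x - a) ^ n) sums f x"
    unfolding powser_at_def by (rule exE)
  then obtain r where "r > 0" "\<forall>x\<in>S. \<bar>x - a\<bar> < r \<longrightarrow> (\<lambda>n. c n * (x - a) ^ n) sums f x"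
    by (elim exE conjE)
  then show thesis using that[of r c] by simp
qed

lemma real_analytic_on_iff_powser_at:
  "real_analytic_on f S \<longleftrightarrow> (\<forall>a\<in>S. powser_at f a S)"
proof
  assume L: "real_analytic_on f S"
  show "\<forall>a\<in>S. powser_at f a S"
  proof
    fix a assume "a \<in> S"
    then have "\<exists>c U. openin (top_of_set S) U \<and> a \<in> U \<and> (\<forall>x\<in>U. (\<lambda>n. c n * (x - a) ^ n) sums f x)"
      using L by (simp add: real_analytic_on_def)
    then obtain c U where U: "openin (top_of_set S) U" "a \<in> U"
      "\<forall>x\<in>U. (\<lambda>n. c n * (x - a) ^ n) sums f x"
      by (elim exE conjE)
    from U(1,2) obtain r where "r > 0" "ball a r \<inter> S \<subseteq> U"
      unfolding openin_contains_ball by blast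
    then show "powser_at f a S"
      using U(3) by (intro powser_atI[of r _ _ c]) (auto simp: subset_iff dist_real_def abs_minus_commute)
  qed
next
  assume R: "\<forall>a\<in>S. powser_at f a S"
  show "real_analytic_on f S"
    unfolding real_analytic_on_def
  proof
    fix a assume a: "a \<in> S"
    then have "powser_at f a S" using R by blast
    then obtain c r where r: "r > 0"
      "\<And>x. x \<in> S \<Longrightarrow> \<bar>x - a\<bar> < r \<Longrightarrow> (\<lambda>n. c n * (x - a) ^ n) sums f x"
      by (rule powser_atE) blast
    have "openin (top_of_set S) (S \<inter> ball a r)"
      by (simp add: openin_open_Int)
    then show "\<exists>c U. openin (top_of_set S) U \<and> a \<in> U \<and> (\<forall>x\<in>U. (\<lambda>n. c n * (x - a) ^ n) sums f x)"
      using a r by (intro exI[of _ c] exI[of _ "S \<inter> ball a r"])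
        (auto simp: dist_real_def abs_minus_commute)
  qed
qed

text \<open>Being analytic at \<open>a\<close> is local. This serves for a quotient whose value at
  the root is set by hand, and for restrictions to the interval.\<close>

lemma powser_at_cong:
  assumes "powser_at f a S" "e > 0" "\<And>x. x \<in> S \<Longrightarrow> \<bar>x - a\<bar> < e \<Longrightarrow> f x = g x"
  shows "powser_at g a S"
proof -
  obtain c r where r: "r > 0"
    "\<And>x. x \<in> S \<Longrightarrow> \<bar>x - a\<bar> < r \<Longrightarrow> (\<lambda>n. c n * (x - a) ^ n) sums f x"
    using assms(1) by (rule powser_atE) blast
  show ?thesis
    using assms(2) r by (intro powser_atI[of "min r e"]) (auto simp flip: assms(3))
qed

section \<open>Local expansions of elementary functions, sums and products\<close>

lemma powser_at_const: "powser_at (\<lambda>x. k) a S"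
proof (rule powser_atI[of 1])
  fix x :: real
  show "(\<lambda>n. (if n = 0 then k else 0) * (x - a) ^ n) sums k"
    using sums_finite[of "{0}" "\<lambda>n. (if n = 0 then k else 0) * (x - a) ^ n"] by simp
qed simp

lemma powser_at_diff_const: "powser_at (\<lambda>x. x - k) a S"
proof (rule powser_atI[of 1])
  fix x :: real
  let ?c = "\<lambda>n::nat. if n = 0 then a - k else if n = 1 then 1 else 0"
  show "(\<lambda>n. ?c n * (x - a) ^ n) sums (x - k)"
    using sums_finite[of "{0, 1}" "\<lambda>n. ?c n * (x - a) ^ n"] by simp
qed simp

text \<open>Write \<open>x - k = (a - k) * (1 - q)\<close> with \<open>q\<close> proportional to
  \<open>x - a\<close>. The geometric series in \<open>q\<close> converges as long as
  \<open>x\<close> is closer to \<open>a\<close> than \<open>k\<close> is.\<close>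

lemma powser_at_inverse_diff_const:
  assumes "a \<noteq> k"
  shows "powser_at (\<lambda>x. inverse (x - k)) a S"
proof (rule powser_atI[of "\<bar>a - k\<bar>"])
  fix x :: real assume x: "\<bar>x - a\<bar> < \<bar>a - k\<bar>"
  define q where "q = - (x - a) / (a - k)"
  have "\<bar>q\<bar> < 1" using x assms by (simp add: q_def abs_minus_commute)
  then have "(\<lambda>n. inverse (a - k) * q ^ n) sums (inverse (a - k) * (1 / (1 - q)))"
    by (intro sums_mult geometric_sums) simp
  moreover have "inverse (a - k) * (1 / (1 - q)) = inverse (x - k)"
    using assms by (simp add: q_def divide_simps)
  moreover have "inverse (a - k) * q ^ n = (inverse (a - k) * (- 1 / (a - k)) ^ n) * (x - a) ^ n" for n
  proof -
    have "q = (- 1 / (a - k)) * (x - a)"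
      using assms by (simp add: q_def field_simps)
    then show ?thesis by (simp only: power_mult_distrib mult.assoc)
  qed
  ultimately show "(\<lambda>n. (inverse (a - k) * (- 1 / (a - k)) ^ n) * (x - a) ^ n) sums inverse (x - k)"
    by simp
qed (use assms in simp)

lemma powser_at_add:
  assumes "powser_at f a S" "powser_at g a S"
  shows "powser_at (\<lambda>x. f x + g x) a S"
proof -
  obtain c r where r: "r > 0"
    "\<And>x. x \<in> S \<Longrightarrow> \<bar>x - a\<bar> < r \<Longrightarrow> (\<lambda>n. c n * (x - a) ^ n) sums f x"
    using assms(1) by (rule powser_atE) blast
  obtain d s where s: "s > 0"
    "\<And>x. x \<in> S \<Longrightarrow> \<bar>x - a\<bar> < s \<Longrightarrow> (\<lambda>n. d n * (x - a) ^ n) sums g x"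
    using assms(2) by (rule powser_atE) blast
  show ?thesis
    using r s by (intro powser_atI[of "min r s" _ _ "\<lambda>n. c n + d n"])
      (auto simp: ring_distribs intro!: sums_add)
qed

text \<open>
  The series is only known to converge at points of the interval, so absolute convergence at \<open>x\<close>
  is obtained from a point of the interval further away from \<open>a\<close> than \<open>x\<close>, on either side.
\<close>

lemma powser_summable_norm:
  fixes c :: "nat \<Rightarrow> real"
  assumes "a \<in> {0..1}" "\<bar>x - a\<bar> < r" "r \<le> 1 / 2"
    and "\<And>y. y \<in> {0..1} \<Longrightarrow> \<bar>y - a\<bar> < r \<Longrightarrow> summable (\<lambda>n. c n * (y - a) ^ n)"
  shows "summable (\<lambda>n. norm (c n * (x - a) ^ n))"
proof -
  define s where "s = (\<bar>x - a\<bar> + r) / 2"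
  have s: "\<bar>x - a\<bar> < s" "s < r" using assms(2) by (auto simp: s_def)
  \<comment> \<open>Since \<open>s < 1 / 2\<close>, moving by \<open>s\<close> towards the more
    distant endpoint stays in the interval, even if \<open>a\<close> is itself an endpoint.\<close>
  define y where "y = (if a \<le> 1 / 2 then a + s else a - s)"
  have y: "y \<in> {0..1}" "\<bar>y - a\<bar> = s" using assms(1,3) s by (auto simp: y_def)
  have "summable (\<lambda>n. c n * (y - a) ^ n)" using assms(4) y s by simp
  then show ?thesis by (rule powser_insidea) (use y s in simp)
qed

text \<open>The coefficients are those of the Cauchy product, which converges to the product of the
  sums because both series converge absolutely.\<close>

lemma powser_at_mult:
  assumes a: "a \<in> {0..1}" and "powser_at f a {0..1}" "powser_at g a {0..1}"
  shows "powser_at (\<lambda>x. f x * g x) a {0..1}"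
proof -
  obtain c r where r: "r > 0"
    "\<And>x. x \<in> {0..1} \<Longrightarrow> \<bar>x - a\<bar> < r \<Longrightarrow> (\<lambda>n. c n * (x - a) ^ n) sums f x"
    using assms(2) by (rule powser_atE) blast
  obtain d s where s: "s > 0"
    "\<And>x. x \<in> {0..1} \<Longrightarrow> \<bar>x - a\<bar> < s \<Longrightarrow> (\<lambda>n. d n * (x - a) ^ n) sums g x"
    using assms(3) by (rule powser_atE) blast
  \<comment> \<open>The cap \<open>1 / 2\<close> is what \<open>powser_summable_norm\<close>
    requires of a radius.\<close>
  define t where "t = min (min r s) (1 / 2)"
  have t: "t > 0" "t \<le> r" "t \<le> s" "t \<le> 1 / 2" using r s by (auto simp: t_def)
  show ?thesis
  proof (rule powser_atI[OF t(1)])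
    fix x :: real assume x: "x \<in> {0..1}" "\<bar>x - a\<bar> < t"
    have f: "(\<lambda>n. c n * (x - a) ^ n) sums f x" and g: "(\<lambda>n. d n * (x - a) ^ n) sums g x"
      using x t r s by auto
    have "summable (\<lambda>n. norm (c n * (x - a) ^ n))"
      using r t by (intro powser_summable_norm[OF a x(2) t(4)] sums_summable[OF r(2)]) auto
    moreover have "summable (\<lambda>n. norm (d n * (x - a) ^ n))"
      using s t by (intro powser_summable_norm[OF a x(2) t(4)] sums_summable[OF s(2)]) auto
    ultimately have "(\<lambda>k. \<Sum>i\<le>k. (c i * (x - a) ^ i) * (d (k - i) * (x - a) ^ (k - i))) sums (f x * g x)"
      unfolding sums_unique[OF f] sums_unique[OF g] by (rule Cauchy_product_sums)
    moreover have "(\<Sum>i\<le>k. (c i * (x - a) ^ i) * (d (k - i) * (x - a) ^ (k - i)))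
        = (\<Sum>i\<le>k. c i * d (k - i)) * (x - a) ^ k" for k
      unfolding sum_distrib_right
    proof (rule sum.cong)
      fix i assume "i \<in> {..k}"
      then have "(x - a) ^ k = (x - a) ^ i * (x - a) ^ (k - i)"
        by (simp flip: power_add)
      then show "(c i * (x - a) ^ i) * (d (k - i) * (x - a) ^ (k - i)) = c i * d (k - i) * (x - a) ^ k"
        by simp
    qed simp
    ultimately show "(\<lambda>k. (\<Sum>i\<le>k. c i * d (k - i)) * (x - a) ^ k) sums (f x * g x)"
      by simp
  qed
qed

lemma real_analytic_on_divide_root:
  assumes f: "real_analytic_on f {0..1}" and k: "k \<in> {0..1}" "f k = 0"
  obtains g where "real_analytic_on g {0..1}" "\<And>x. x \<in> {0..1} \<Longrightarrow> f x = g x * (x - k)"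
proof -
  have "powser_at f k {0..1}" using f k(1) by (simp add: real_analytic_on_iff_powser_at)
  then obtain c r where r: "r > 0"
    "\<And>x. x \<in> {0..1} \<Longrightarrow> \<bar>x - k\<bar> < r \<Longrightarrow> (\<lambda>n. c n * (x - k) ^ n) sums f x"
    by (rule powser_atE) blast
  \<comment> \<open>At the centre \<open>k\<close> the series reduces to its constant term, which is
    thus \<open>f k\<close>.\<close>
  have "c 0 = 0"
    using r(2)[OF k(1)] r(1) k(2) powser_sums_zero_iff[of c "f k"] by simp
  \<comment> \<open>\<open>c 1\<close> is the value of the shifted series at its centre; any other
    choice would make \<open>g\<close> discontinuous at \<open>k\<close>.\<close>
  define g where "g x = (if x = k then c 1 else f x / (x - k))" for x
  have "powser_at g a {0..1}" if a: "a \<in> {0..1}" for a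
  proof (cases "a = k")
    case True
    have "(\<lambda>n. c (Suc n) * (x - k) ^ n) sums g x" if x: "x \<in> {0..1}" "\<bar>x - k\<bar> < r" for x
    proof (cases "x = k")
      case True
      then show ?thesis using powser_sums_zero_iff[of "\<lambda>n. c (Suc n)" "c 1"] by (simp add: g_def)
    next
      case False
      have "(\<lambda>n. c (Suc n) * (x - k) ^ Suc n) sums f x"
        using r(2)[OF x] \<open>c 0 = 0\<close> by (subst sums_Suc_iff) simp
      then have "(\<lambda>n. c (Suc n) * (x - k) ^ Suc n / (x - k)) sums (f x / (x - k))"
        by (rule sums_divide)
      then show ?thesis using False by (simp add: g_def)
    qed
    then show ?thesis using r(1) True by (auto intro: powser_atI[of r _ _ "\<lambda>n. c (Suc n)"])
  next
    case False
    have "powser_at (\<lambda>x. f x * inverse (x - k)) a {0..1}"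
      using f a False
      by (intro powser_at_mult powser_at_inverse_diff_const)
        (auto simp: real_analytic_on_iff_powser_at)
    then show ?thesis
      \<comment> \<open>The radius \<open>\<bar>a - k\<bar>\<close> keeps \<open>x\<close> away from
        \<open>k\<close>, where \<open>g\<close> is not given by the quotient.\<close>
      by (rule powser_at_cong[where e = "\<bar>a - k\<bar>"]) (use False in \<open>auto simp: g_def divide_inverse\<close>)
  qed
  then have "real_analytic_on g {0..1}" by (simp add: real_analytic_on_iff_powser_at)
  \<comment> \<open>At \<open>x = k\<close> both sides vanish, whatever value \<open>g\<close> has
    there.\<close>
  moreover have "f x = g x * (x - k)" for x using k by (simp add: g_def)
  ultimately show thesis using that by blast
qed

section \<open>The commutative ring of analytic functions on the unit interval\<close>

lemma carrier_analytic_ring: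
  "f \<in> carrier analytic_ring \<longleftrightarrow> f \<in> extensional {0..1} \<and> (\<forall>a\<in>{0..1}. powser_at f a {0..1})"
  by (simp add: analytic_ring_def real_analytic_on_iff_powser_at)

lemma restrict_in_carrier:
  assumes "\<And>a. a \<in> {0..1} \<Longrightarrow> powser_at f a {0..1}"
  shows "(\<lambda>x\<in>{0..1}. f x) \<in> carrier analytic_ring"
  unfolding carrier_analytic_ring
  \<comment> \<open>Only points of the interval matter to \<open>powser_at\<close>, and there
    restriction changes nothing, so any positive \<open>e\<close> would do.\<close>
  by (auto intro: powser_at_cong[OF assms, where e = 1])

lemma analytic_ring_ops:
  "f \<otimes>\<^bsub>analytic_ring\<^esub> g = (\<lambda>x\<in>{0..1}. f x * g x)"
  "f \<oplus>\<^bsub>analytic_ring\<^esub> g = (\<lambda>x\<in>{0..1}. f x + g x)"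
  "\<one>\<^bsub>analytic_ring\<^esub> = (\<lambda>x\<in>{0..1}. 1)"
  "\<zero>\<^bsub>analytic_ring\<^esub> = (\<lambda>x\<in>{0..1}. 0)"
  by (simp_all add: analytic_ring_def)

lemma analytic_ring_closed:
  "f \<in> carrier analytic_ring \<Longrightarrow> g \<in> carrier analytic_ring \<Longrightarrow>
    f \<oplus>\<^bsub>analytic_ring\<^esub> g \<in> carrier analytic_ring"
  "f \<in> carrier analytic_ring \<Longrightarrow> g \<in> carrier analytic_ring \<Longrightarrow>
    f \<otimes>\<^bsub>analytic_ring\<^esub> g \<in> carrier analytic_ring"
  "\<zero>\<^bsub>analytic_ring\<^esub> \<in> carrier analytic_ring"
  "\<one>\<^bsub>analytic_ring\<^esub> \<in> carrier analytic_ring"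
  unfolding analytic_ring_ops
  by (intro restrict_in_carrier powser_at_add powser_at_mult powser_at_const;
      simp add: carrier_analytic_ring)+

lemma cring_analytic_ring: "cring analytic_ring"
proof (rule cringI)
  show "abelian_group analytic_ring"
  proof (rule abelian_groupI)
    fix f assume f: "f \<in> carrier analytic_ring"
    then show "\<zero>\<^bsub>analytic_ring\<^esub> \<oplus>\<^bsub>analytic_ring\<^esub> f = f"
      by (auto simp: analytic_ring_ops carrier_analytic_ring extensional_def restrict_def)
    \<comment> \<open>Writing the negative as a product with a constant lets closure under products
      cover it.\<close>
    have "(\<lambda>x\<in>{0..1}. - 1 * f x) \<in> carrier analytic_ring"
      using f by (intro restrict_in_carrier powser_at_mult powser_at_const)
        (auto simp: carrier_analytic_ring)
    then show "\<exists>g\<in>carrier analytic_ring. g \<oplus>\<^bsub>analytic_ring\<^esub> f = \<zero>\<^bsub>analytic_ring\<^esub>"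
      by (rule rev_bexI) (auto simp: analytic_ring_ops)
  qed (simp_all add: analytic_ring_closed, auto simp: analytic_ring_ops add_ac)
  show "comm_monoid analytic_ring"
  proof (rule comm_monoidI)
    fix f assume "f \<in> carrier analytic_ring"
    then show "\<one>\<^bsub>analytic_ring\<^esub> \<otimes>\<^bsub>analytic_ring\<^esub> f = f"
      by (auto simp: analytic_ring_ops carrier_analytic_ring extensional_def restrict_def)
  qed (simp_all add: analytic_ring_closed, auto simp: analytic_ring_ops mult_ac)
qed (auto simp: analytic_ring_ops ring_distribs)

theorem theorem1:
  fixes \<gamma> :: real
  assumes "\<gamma> \<in> {0..1}"
  shows "principalideal (vanishing_ideal \<gamma>) analytic_ring \<and>
         vanishing_ideal \<gamma> = Idl\<^bsub>analytic_ring\<^esub> {\<lambda>x\<in>{0..1}. x - \<gamma>}"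
proof -
  interpret cring analytic_ring by (rule cring_analytic_ring)
  let ?i = "\<lambda>x\<in>{0..1}. x - \<gamma>"
  have i: "?i \<in> carrier analytic_ring"
    by (intro restrict_in_carrier powser_at_diff_const)
  \<comment> \<open>\<open>PIdl\<close> is the explicit set of multiples of \<open>?i\<close>; in a
    commutative ring it coincides with the generated ideal \<open>Idl\<close>.\<close>
  have "vanishing_ideal \<gamma> = PIdl\<^bsub>analytic_ring\<^esub> ?i"
  proof
    show "vanishing_ideal \<gamma> \<subseteq> PIdl\<^bsub>analytic_ring\<^esub> ?i"
    proof
      fix f assume f: "f \<in> vanishing_ideal \<gamma>"
      then have ext: "f \<in> extensional {0..1}" and "real_analytic_on f {0..1}" "f \<gamma> = 0"
        by (auto simp: vanishing_ideal_def analytic_ring_def)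
      then obtain g where g: "real_analytic_on g {0..1}"
        "\<And>x. x \<in> {0..1} \<Longrightarrow> f x = g x * (x - \<gamma>)"
        using real_analytic_on_divide_root assms by blast
      have "(\<lambda>x\<in>{0..1}. g x) \<in> carrier analytic_ring"
        using g(1) by (intro restrict_in_carrier) (simp add: real_analytic_on_iff_powser_at)
      \<comment> \<open>Both sides are extensional, so agreement on the interval gives equality of
        functions.\<close>
      moreover have "f = (\<lambda>x\<in>{0..1}. g x) \<otimes>\<^bsub>analytic_ring\<^esub> ?i"
        using g(2) ext by (auto simp: analytic_ring_ops extensional_def restrict_def)
      ultimately show "f \<in> PIdl\<^bsub>analytic_ring\<^esub> ?i"
        unfolding cgenideal_def by blast
    qed
    show "PIdl\<^bsub>analytic_ring\<^esub> ?i \<subseteq> vanishing_ideal \<gamma>"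
      using assms i m_closed[OF _ i]
      by (auto simp: cgenideal_def vanishing_ideal_def) (simp add: analytic_ring_ops)
  qed
  then show ?thesis
    using cgenideal_is_principalideal[OF i] cgenideal_eq_genideal[OF i] by simp
qed

end
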